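(* If the maximal terminal unit-band suffix of the Havel--Hakimi trajectory of a graphic sequence is nonempty and begins with pivot $D_*$, then its total defect is at most \[ \frac32-\frac1{D_*}-\frac1{D_*+1}<\frac32 . \] If the suffix is empty, its total defect is zero. In particular, every terminal unit-band suffix contributes at most $3/2$.
   Context: A finite sequence of nonnegative integers is graphic if it is the degree sequence of a finite simple graph. For a nonincreasing graphic sequence $\mathbf d=(d_1,\ldots,d_t)$ with $d_1=D>0$, its Havel--Hakimi reduction is obtained by deleting $d_1=D$ (the pivot), subtracting one from each of $d_2,\ldots,d_{D+1}$ (the selected entries, positive by graphicality), and reordering in nonincreasing order. Repeating while the largest term is positive gives the trajectory $\mathbf d^{(0)},\ldots,\mathbf d^{(s)}$ ending at an all-zero sequence; step $j$ ($0\le j<s$) is the passage from $\mathbf d^{(j)}$ to $\mathbf d^{(j+1)}$, with pivot $D_j=d^{(j)}_1$. The defect of step $j$ is \[ \delta_j=\sum_{i=2}^{D_j+1}\frac{1}{d_i^{(j)}(d_i^{(j)}+1)}-\frac{1}{D_j+1}, \] which equals $\operatorname{CW}(\mathbf d^{(j+1)})-\operatorname{CW}(\mathbf d^{(j)})$, where $\operatorname{CW}(\mathbf d)=\sum_i\frac1{d_i+1}$. A step with pivot $D$ is a unit-band step if every selected degree (before subtraction) belongs to $\{D,D-1\}$. The (maximal) terminal unit-band suffix is the part of the trajectory beginning with its first unit-band step and ending with the all-zero sequence; it is empty if there is no unit-band step. Its total defect is the sum of $\delta_j$ over its steps. *)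

theory Defs
  imports Complex_Main "HOL-Library.Sublist"
begin

definition simple_graph :: "'a set \<Rightarrow> ('a \<times> 'a) set \<Rightarrow> bool" where
  "simple_graph V E \<longleftrightarrow> finite V \<and> E \<subseteq> V \<times> V \<and> sym E \<and> irrefl E"

definition degree :: "('a \<times> 'a) set \<Rightarrow> 'a \<Rightarrow> nat" where
  "degree E v = card (E `` {v})"

text \<open>Natural numbers as vertices lose no generality, since the graphs are finite. The list
  \<open>vs\<close> enumerates the vertices in the order in which the degrees are listed.\<close>

definition graphic :: "nat list \<Rightarrow> bool" where
  "graphic d \<longleftrightarrow> (\<exists>(V :: nat set) E vs.
     simple_graph V E \<and> distinct vs \<and> set vs = V \<and> d = map (degree E) vs)"

abbreviation nonincreasing :: "nat list \<Rightarrow> bool" where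
  "nonincreasing \<equiv> sorted_wrt (\<ge>)"

text \<open>The next definitions concern a single step, made from a nonincreasing graphic sequence
  whose first entry is positive. Graphicality guarantees that \<open>selected\<close> really has
  \<open>pivot\<close> many entries and that they are positive, so neither \<open>take\<close>, nor the truncated
  subtraction, nor the division below takes a degenerate value.\<close>

definition pivot :: "nat list \<Rightarrow> nat" where
  "pivot d = hd d"

definition selected :: "nat list \<Rightarrow> nat list" where
  "selected d = take (pivot d) (tl d)"

definition hh_reduce :: "nat list \<Rightarrow> nat list" where
  "hh_reduce d = rev (sort (map (\<lambda>x. x - 1) (selected d) @ drop (pivot d) (tl d)))"

definition defect :: "nat list \<Rightarrow> real" where
  "defect d = (\<Sum>x\<leftarrow>selected d. 1 / (real x * (real x + 1))) - 1 / (real (pivot d) + 1)"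

definition unit_band :: "nat list \<Rightarrow> bool" where
  "unit_band d \<longleftrightarrow> set (selected d) \<subseteq> {pivot d, pivot d - 1}"

lemma length_hh_reduce: "length (hh_reduce d) = length d - 1"
  by (simp add: hh_reduce_def selected_def)

function hh_trajectory :: "nat list \<Rightarrow> nat list list" where
  "hh_trajectory d =
     (if d = [] \<or> pivot d = 0 then [d] else d # hh_trajectory (hh_reduce d))"
  by pat_completeness auto
termination
  by (relation "measure length") (auto simp: length_hh_reduce)

declare hh_trajectory.simps [simp del]

text \<open>A step is represented by the sequence it starts from, so every member of the trajectory
  except the final all-zero one stands for a step, and a suffix of the trajectory is
  represented by the list of its steps.\<close>

definition hh_steps :: "nat list \<Rightarrow> nat list list" where
  "hh_steps d = butlast (hh_trajectory d)"

definition unit_band_suffix :: "nat list \<Rightarrow> nat list list" where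
  "unit_band_suffix d = dropWhile (\<lambda>e. \<not> unit_band e) (hh_steps d)"

definition is_terminal_unit_band_suffix :: "nat list list \<Rightarrow> nat list \<Rightarrow> bool" where
  "is_terminal_unit_band_suffix es d \<longleftrightarrow> suffix es (hh_steps d) \<and> (\<forall>e\<in>set es. unit_band e)"

definition total_defect :: "nat list list \<Rightarrow> real" where
  "total_defect es = (\<Sum>e\<leftarrow>es. defect e)"

end

theory Submission
  imports Defs
begin

text \<open>
  A unit-band step is followed only by unit-band steps, since subtraction leaves enough entries
  within one of the next maximum. Write \<open>b D = 3/2 - 1/D - 1/(D+1)\<close>. If the pivot does not
  drop, then an unselected entry equals \<open>D\<close>, so all selected entries equal \<open>D\<close> and the defect
  is at most zero. Otherwise the selected entries are at least \<open>D - 1\<close>, so the defect is at most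
  \<open>1/(D-1) - 1/(D+1) = b D - b (D-1)\<close>. Telescoping gives the bound \<open>b D\<^sub>*\<close>.
\<close>

section \<open>The bounding function\<close>

text \<open>At \<open>D = 0\<close> the formula would give \<open>1/2\<close>, which breaks monotonicity at \<open>D = 1\<close>.\<close>

definition band_bound :: "nat \<Rightarrow> real" where
  "band_bound D = (if D = 0 then 0 else 3/2 - 1 / real D - 1 / (real D + 1))"

lemma band_bound_mono: "m \<le> n \<Longrightarrow> band_bound m \<le> band_bound n"
proof (induction n rule: dec_induct)
  case (step n)
  have "band_bound n \<le> band_bound (Suc n)"
  proof (cases n)
    case (Suc k)
    \<comment> \<open>The increment from k + 1 to k + 2 is 1/(k+1) - 1/(k+3), since the 1/(k+2)
      terms cancel.\<close>
    have "1 / (real k + 3) \<le> 1 / (real k + 1)" by (intro frac_le) auto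
    with Suc show ?thesis by (simp add: band_bound_def add.commute)
  qed (simp add: band_bound_def)
  with step.IH show ?case by simp
qed simp

lemma band_bound_nonneg: "0 \<le> band_bound n"
  using band_bound_mono[of 0 n] by (simp add: band_bound_def)

lemma band_bound_less: "band_bound n < 3/2"
proof (cases n)
  case (Suc k)
  have "0 < 1 / real n + 1 / (real n + 1)" using Suc by (intro add_pos_pos) simp_all
  with Suc show ?thesis unfolding band_bound_def by simp
qed (simp add: band_bound_def)

section \<open>Reduction steps and persistence of the unit band\<close>

lemma hh_steps_rec:
  "hh_steps d = (if d = [] \<or> pivot d = 0 then [] else d # hh_steps (hh_reduce d))"
proof -
  have "hh_trajectory e \<noteq> []" for e
    by (subst hh_trajectory.simps) simp
  then show ?thesis
    by (simp add: hh_steps_def hh_trajectory.simps[of d])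
qed

lemma nonincreasing_hh_reduce: "nonincreasing (hh_reduce d)"
  by (simp add: hh_reduce_def sorted_wrt_rev)

lemma set_hh_reduce:
  "set (hh_reduce d) = (\<lambda>x. x - 1) ` set (selected d) \<union> set (drop (pivot d) (tl d))"
  by (simp add: hh_reduce_def)

lemma pivot_in_set: "d \<noteq> [] \<Longrightarrow> pivot d \<in> set d"
  by (simp add: pivot_def)

lemma set_tl_split: "set (tl d) = set (selected d) \<union> set (drop (pivot d) (tl d))"
  unfolding selected_def by (metis append_take_drop_id set_append)

lemma tl_le_pivot: "nonincreasing d \<Longrightarrow> x \<in> set (tl d) \<Longrightarrow> x \<le> pivot d"
  by (cases d) (auto simp: pivot_def)

lemma pivot_hh_reduce_le:
  assumes "nonincreasing d" "hh_reduce d \<noteq> []"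
  shows "pivot (hh_reduce d) \<le> pivot d"
proof -
  have "x \<le> pivot d" if "x \<in> set (hh_reduce d)" for x
    using that tl_le_pivot[OF assms(1)] unfolding set_hh_reduce set_tl_split by fastforce
  then show ?thesis using pivot_in_set[OF assms(2)] by blast
qed

text \<open>A decremented entry is at most D - 1, so a maximum that is still D comes from an
  unselected entry. Selected entries precede it in the order, hence equal D too.\<close>

lemma selected_if_pivot_kept:
  assumes ni: "nonincreasing d" and ne: "hh_reduce d \<noteq> []" and pos: "pivot d > 0"
    and eq: "pivot (hh_reduce d) = pivot d" and x: "x \<in> set (selected d)"
  shows "x = pivot d"
proof -
  have le: "y \<le> pivot d" if "y \<in> set (selected d)" for y
    using that tl_le_pivot[OF ni] by (auto simp: set_tl_split)
  have "pivot d \<in> set (hh_reduce d)" using pivot_in_set[OF ne] eq by simp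
  moreover have "pivot d \<notin> (\<lambda>x. x - 1) ` set (selected d)" using le pos by fastforce
  ultimately have r: "pivot d \<in> set (drop (pivot d) (tl d))" by (simp add: set_hh_reduce)
  have "nonincreasing (tl d)" using ni by (cases d) auto
  then have "nonincreasing (selected d @ drop (pivot d) (tl d))" by (simp add: selected_def)
  then have "pivot d \<le> x" using r x by (auto simp: sorted_wrt_append)
  with le[OF x] show ?thesis by simp
qed

text \<open>The entries at least \<open>c\<close> form an initial segment, so more than
  \<open>n\<close> of them cover the head and the next \<open>n\<close> positions.\<close>

lemma nonincreasing_take_ge:
  fixes c :: nat
  assumes ni: "nonincreasing xs" and len: "n < length (filter (\<lambda>x. c \<le> x) xs)"
    and x: "x \<in> set (take n (tl xs))"
  shows "c \<le> x"
proof (rule ccontr)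
  assume nx: "\<not> c \<le> x"
  obtain i where i: "i < n" "Suc i < length xs" "x = xs ! Suc i"
    using x by (auto simp: in_set_conv_nth nth_tl)
  have "y \<le> x" if y: "y \<in> set (drop (Suc i) xs)" for y
  proof -
    obtain j where j: "j < length (drop (Suc i) xs)" "y = drop (Suc i) xs ! j"
      using y unfolding in_set_conv_nth by blast
    then show ?thesis
      using sorted_wrt_nth_less[OF ni, of "Suc i" "Suc i + j"] i by (cases "j = 0") auto
  qed
  then have "\<forall>y \<in> set (drop (Suc i) xs). \<not> c \<le> y" using nx by fastforce
  then have "filter (\<lambda>x. c \<le> x) (drop (Suc i) xs) = []" by (simp add: filter_empty_conv)
  then have "filter (\<lambda>x. c \<le> x) xs = filter (\<lambda>x. c \<le> x) (take (Suc i) xs)"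
    by (metis append_Nil2 append_take_drop_id filter_append)
  then have "length (filter (\<lambda>x. c \<le> x) xs) \<le> Suc i"
    using length_filter_le[of "\<lambda>x. c \<le> x" "take (Suc i) xs"] by simp
  with len i show False by simp
qed

lemma unit_band_hh_reduce:
  assumes ni: "nonincreasing d" and pos: "pivot d > 0" and ub: "unit_band d"
    and ne: "hh_reduce d \<noteq> []"
  shows "unit_band (hh_reduce d)"
proof -
  let ?e = "hh_reduce d" and ?D = "pivot d" and ?S = "selected d" and ?R = "drop (pivot d) (tl d)"
  let ?c = "pivot ?e - 1" and ?P = "\<lambda>x. pivot ?e - 1 \<le> x"
  have ni': "nonincreasing ?e" by (rule nonincreasing_hh_reduce)
  have le: "pivot ?e \<le> ?D" by (rule pivot_hh_reduce_le[OF ni ne])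
  \<comment> \<open>If the pivot is kept, selected entries become D - 1; otherwise they stay at
    least D - 2 while the new pivot is at most D - 1.\<close>
  have A: "?c \<le> x - 1" if "x \<in> set ?S" for x
  proof (cases "pivot ?e = ?D")
    case True
    with selected_if_pivot_kept[OF ni ne pos _ that] show ?thesis by simp
  next
    case False
    have "x = ?D \<or> x = ?D - 1" using ub that by (auto simp: unit_band_def)
    with False le show ?thesis by auto
  qed
  have ge: "?c \<le> x" if x: "x \<in> set (selected ?e)" for x
  \<comment> \<open>Without unselected entries, every entry of \<open>?e\<close> is a decremented
    one and \<open>A\<close> suffices. Otherwise exactly D entries were decremented and can be
    counted.\<close>
  proof (cases "?R = []")
    case True
    have "x \<in> set ?e"
      using x unfolding selected_def by (meson in_set_takeD list.set_sel(2) ne)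
    with True A show ?thesis by (auto simp: set_hh_reduce)
  next
    case False
    have "filter ?P (map (\<lambda>x. x - 1) ?S) = map (\<lambda>x. x - 1) ?S"
      using A by (auto simp: filter_id_conv)
    moreover have "length ?S = ?D" using False by (simp add: selected_def)
    ultimately have len: "length (filter ?P ?e) = ?D + length (filter ?P ?R)"
      by (simp add: hh_reduce_def rev_filter[symmetric] filter_sort)
    \<comment> \<open>The inequality is strict because the new pivot itself is counted. The D
      decremented entries suffice if the pivot dropped; if it was kept, an unselected entry equal to
      D supplies one more.\<close>
    have "pivot ?e < length (filter ?P ?e)"
    proof (cases "pivot ?e = ?D")
      case True
      have "?D \<notin> (\<lambda>x. x - 1) ` set ?S"
        using selected_if_pivot_kept[OF ni ne pos True] pos by force
      then have "?D \<in> set (filter ?P ?R)"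
        using pivot_in_set[OF ne] True by (auto simp: set_hh_reduce)
      then have "filter ?P ?R \<noteq> []" by (metis empty_iff list.set(1))
      then show ?thesis using len True by simp
    qed (use le len in simp)
    then show ?thesis by (rule nonincreasing_take_ge[OF ni' _ x[unfolded selected_def]])
  qed
  have "x \<le> pivot ?e" if "x \<in> set (selected ?e)" for x
    using that tl_le_pivot[OF ni'] by (auto simp: set_tl_split)
  with ge show ?thesis by (force simp: unit_band_def)
qed

section \<open>Defect of a single step\<close>

lemma defect_le:
  assumes "\<And>x. x \<in> set (selected d) \<Longrightarrow> 1 / (real x * (real x + 1)) \<le> c" and "0 \<le> c"
  shows "defect d \<le> real (pivot d) * c - 1 / (real (pivot d) + 1)"
proof -
  have "(\<Sum>x\<leftarrow>selected d. 1 / (real x * (real x + 1))) \<le> (\<Sum>x\<leftarrow>selected d. c)"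
    by (rule sum_list_mono) (use assms in auto)
  also have "\<dots> = real (length (selected d)) * c" by (simp add: sum_list_triv)
  \<comment> \<open>\<open>take\<close> yields at most \<open>pivot d\<close> entries, so the sign
    of \<open>c\<close> matters.\<close>
  also have "\<dots> \<le> real (pivot d) * c"
    by (rule mult_right_mono) (use assms in \<open>auto simp: selected_def\<close>)
  finally show ?thesis by (simp add: defect_def)
qed

text \<open>Each selected entry equals D, so the sum is at most D/(D(D+1)) = 1/(D+1), which the
  subtracted term cancels.\<close>

lemma defect_nonpos_if_pivot_kept:
  assumes "nonincreasing d" "hh_reduce d \<noteq> []" "pivot d > 0" "pivot (hh_reduce d) = pivot d"
  shows "defect d \<le> 0"
  using defect_le[of d "1 / (real (pivot d) * (real (pivot d) + 1))"]
    selected_if_pivot_kept[OF assms(1,2,3,4)] assms(3)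
  by simp

lemma defect_unit_band_le:
  assumes pos: "pivot d > 0" and ub: "unit_band d"
  shows "defect d \<le> band_bound (pivot d) - band_bound (pivot d - 1)"
proof (cases "pivot d = 1")
  case True
  \<comment> \<open>An entry 1 contributes 1/2, and an entry 0 contributes 1/0 = 0 by convention.
    Both \<open>band_bound 1\<close> and \<open>band_bound 0\<close> vanish.\<close>
  have "defect d \<le> real (pivot d) * (1/2) - 1 / (real (pivot d) + 1)"
    by (rule defect_le) (use ub True in \<open>auto simp: unit_band_def\<close>)
  with True show ?thesis by (simp add: band_bound_def)
next
  case False
  with pos have "pivot d = Suc (Suc (pivot d - 2))" by simp
  then obtain k where k: "pivot d = Suc (Suc k)" by blast
  have "defect d \<le> real (pivot d) * (1 / ((real k + 1) * (real k + 2))) - 1 / (real (pivot d) + 1)"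
  proof (rule defect_le)
    fix x assume "x \<in> set (selected d)"
    then have "Suc k \<le> x" using ub k by (auto simp: unit_band_def)
    then have "(real k + 1) * (real k + 2) \<le> real x * (real x + 1)"
      by (intro mult_mono) auto
    then show "1 / (real x * (real x + 1)) \<le> 1 / ((real k + 1) * (real k + 2))"
      by (intro divide_left_mono) (use \<open>Suc k \<le> x\<close> in auto)
  qed simp
  also have "\<dots> = band_bound (pivot d) - band_bound (pivot d - 1)"
  proof -
    have "real (pivot d) * (1 / ((real k + 1) * (real k + 2))) = 1 / (real k + 1)"
      by (simp add: k divide_simps)
    then show ?thesis by (simp add: k band_bound_def add.commute)
  qed
  finally show ?thesis .
qed

section \<open>Telescoping along the trajectory and its suffixes\<close>

lemma total_defect_unit_band_le:
  assumes "nonincreasing d" "unit_band d"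
  shows "total_defect (hh_steps d) \<le> band_bound (pivot d)"
  using assms
proof (induction "length d" arbitrary: d rule: less_induct)
  case less
  show ?case
  proof (cases "d = [] \<or> pivot d = 0")
    case True
    \<comment> \<open>\<open>pivot []\<close> is unspecified, so nonnegativity of
      \<open>band_bound\<close> at every argument is used.\<close>
    then show ?thesis
      by (simp add: hh_steps_rec[of d] total_defect_def band_bound_nonneg)
  next
    case False
    then have pos: "pivot d > 0" by simp
    let ?e = "hh_reduce d"
    have eq: "total_defect (hh_steps d) = defect d + total_defect (hh_steps ?e)"
      using False by (simp add: hh_steps_rec[of d] total_defect_def)
    have ub: "defect d \<le> band_bound (pivot d) - band_bound (pivot d - 1)"
      by (rule defect_unit_band_le[OF pos less.prems(2)])
    \<comment> \<open>An empty reduction has no meaningful pivot to compare with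
      \<open>pivot d\<close>, so it is treated apart.\<close>
    show ?thesis
    proof (cases "?e = []")
      case True
      then have "total_defect (hh_steps ?e) = 0"
        by (simp add: hh_steps_rec[of "[]"] total_defect_def)
      with eq ub band_bound_nonneg[of "pivot d - 1"] show ?thesis by simp
    next
      case ne: False
      have IH: "total_defect (hh_steps ?e) \<le> band_bound (pivot ?e)"
        by (rule less.hyps)
          (use False in \<open>simp_all add: length_hh_reduce nonincreasing_hh_reduce
            unit_band_hh_reduce[OF less.prems(1) pos less.prems(2) ne]\<close>)
      show ?thesis
      proof (cases "pivot ?e = pivot d")
        case True
        with defect_nonpos_if_pivot_kept[OF less.prems(1) ne pos] IH eq show ?thesis by simp
      next
        case False
        \<comment> \<open>The pivot may fall by several units; monotonicity of
          \<open>band_bound\<close> absorbs the gap.\<close>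
        then have "pivot ?e \<le> pivot d - 1"
          using pivot_hh_reduce_le[OF less.prems(1) ne] by simp
        with band_bound_mono[OF this] IH eq ub show ?thesis by simp
      qed
    qed
  qed
qed

text \<open>Later steps depend only on the sequence reached, so a nonempty suffix is the full step
  list of its own first member and the bound for whole trajectories applies to it.\<close>

lemma suffix_hh_steps:
  assumes "nonincreasing d" "suffix es (hh_steps d)" "es \<noteq> []"
  shows "nonincreasing (hd es) \<and> pivot (hd es) > 0 \<and> es = hh_steps (hd es)"
  using assms
proof (induction "length d" arbitrary: d rule: less_induct)
  case less
  have d: "d \<noteq> []" "pivot d \<noteq> 0"
    using less.prems(2,3) by (auto simp: hh_steps_rec[of d] split: if_splits)
  then have "es = hh_steps d \<or> suffix es (hh_steps (hh_reduce d))"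
    using less.prems(2) by (simp add: hh_steps_rec[of d] suffix_Cons)
  then show ?case
  proof
    assume "es = hh_steps d"
    moreover from this have "hd es = d" using d by (simp add: hh_steps_rec[of d])
    ultimately show ?case using d less.prems(1) by simp
  next
    assume "suffix es (hh_steps (hh_reduce d))"
    moreover have "length (hh_reduce d) < length d" using d by (simp add: length_hh_reduce)
    ultimately show ?case
      using less.hyps less.prems(3) nonincreasing_hh_reduce by blast
  qed
qed

lemma total_defect_suffix_le:
  assumes "nonincreasing d" "suffix es (hh_steps d)" "es \<noteq> []" "unit_band (hd es)"
  shows "total_defect es \<le> band_bound (pivot (hd es))"
proof -
  have ni: "nonincreasing (hd es)" and es: "es = hh_steps (hd es)"
    using suffix_hh_steps[OF assms(1-3)] by blast+
  show ?thesis
    using total_defect_unit_band_le[OF ni assms(4)] unfolding es[symmetric] .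
qed

theorem theorem11:
  fixes d :: "nat list"
  assumes "graphic d" and "nonincreasing d"
  shows "(\<forall>D. unit_band_suffix d \<noteq> [] \<and> D = pivot (hd (unit_band_suffix d)) \<longrightarrow>
            total_defect (unit_band_suffix d) \<le> 3/2 - 1 / real D - 1 / (real D + 1) \<and>
            3/2 - 1 / real D - 1 / (real D + 1) < (3/2 :: real)) \<and>
         (unit_band_suffix d = [] \<longrightarrow> total_defect (unit_band_suffix d) = 0) \<and>
         total_defect (unit_band_suffix d) \<le> 3/2 \<and>
         (\<forall>es. is_terminal_unit_band_suffix es d \<longrightarrow> total_defect es \<le> 3/2)"
proof -
  let ?u = "unit_band_suffix d"
  have suf: "suffix ?u (hh_steps d)"
    by (simp add: unit_band_suffix_def suffix_dropWhile)
  have hd: "unit_band (hd ?u)" if "?u \<noteq> []"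
    using that hd_dropWhile[of "\<lambda>e. \<not> unit_band e" "hh_steps d"]
    by (simp add: unit_band_suffix_def)
  have nil: "total_defect [] = 0" by (simp add: total_defect_def)
  \<comment> \<open>Asking for a unit band only at the first step covers both the maximal suffix and
    every other terminal unit-band suffix.\<close>
  have le: "total_defect es \<le> 3/2"
    if "suffix es (hh_steps d)" "es \<noteq> [] \<Longrightarrow> unit_band (hd es)" for es
  proof (cases "es = []")
    case False
    then show ?thesis
      using total_defect_suffix_le[OF assms(2) that(1)] that(2)
        band_bound_less[of "pivot (hd es)"] by force
  qed (simp add: nil)
  have bound: "total_defect ?u \<le> 3/2 - 1 / real D - 1 / (real D + 1) \<and>
      3/2 - 1 / real D - 1 / (real D + 1) < (3/2 :: real)"
    if "?u \<noteq> [] \<and> D = pivot (hd ?u)" for D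
  proof -
    have "D > 0" using suffix_hh_steps[OF assms(2) suf] that by blast
    then have "band_bound D = 3/2 - 1 / real D - 1 / (real D + 1)"
      by (simp add: band_bound_def)
    then show ?thesis
      using total_defect_suffix_le[OF assms(2) suf _ hd] band_bound_less[of D] that by simp
  qed
  show ?thesis
    using bound nil le[OF suf hd] le by (auto simp: is_terminal_unit_band_suffix_def)
qed

end
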